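(* Assume that $h$ and all $h^n$, $n\ge 1$, are continuous and satisfy the mean-reverting assumption: $\langle\theta-\theta^*,h(\theta)\rangle>0$ for all $\theta\in\mathbb{R}^d$, $\theta\neq\theta^*$, and, for every $n\ge1$, $\langle\theta-\theta^{*,n},h^n(\theta)\rangle>0$ for all $\theta\in\mathbb{R}^d$, $\theta\ne\theta^{*,n}$. Suppose moreover that $(h^n)_{n\ge1}$ converges locally uniformly on $\mathbb{R}^d$ towards $h$. Then $$\theta^{*,n}\to\theta^*\quad\text{as } n\to+\infty.$$ Moreover, suppose in addition that $h$ and $h^n$, $n\ge1$, are continuously differentiable, that the Jacobian matrix $Dh(\theta^* )$ is non-singular, and that $(Dh^n)_{n\ge1}$ converges locally uniformly to $Dh$. If there exists $\alpha\in\mathbb{R}\setminus\{0\}$ such that for all $\theta\in\mathbb{R}^d$ the limit $$\lim_{n\to+\infty}n^{\alpha}\big(h^n(\theta)-h(\theta)\big)=:\mathcal{E}(h,\alpha,\theta)$$ exists in $\mathbb{R}^d$, then $$\lim_{n\to+\infty}n^{\alpha}(\theta^{*,n}-\theta^* )=-\big(Dh(\theta^* )\big)^{-1}\mathcal{E}(h,\alpha,\theta^* ).$$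
   Context: Let $H:\mathbb{R}^d\times\mathbb{R}^q\to\mathbb{R}^d$ be a Borel function, $U$ an $\mathbb{R}^q$-valued random vector and $(U^n)_{n\ge1}$ a sequence of $\mathbb{R}^q$-valued random vectors. Set $h(\theta)=\mathbb{E}[H(\theta,U)]$ and $h^n(\theta)=\mathbb{E}[H(\theta,U^n)]$, $\theta\in\mathbb{R}^d$. The point $\theta^*$ denotes the (unique) zero of $h$ and $\theta^{*,n}$ the (unique) zero of $h^n$. *)

theory Defs
  imports "HOL-Analysis.Analysis" "HOL-Probability.Probability"
begin

definition mean_field ::
    "'w measure \<Rightarrow> ((real ^ 'd) \<times> (real ^ 'q) \<Rightarrow> real ^ 'd) \<Rightarrow> ('w \<Rightarrow> real ^ 'q) \<Rightarrow> real ^ 'd \<Rightarrow> real ^ 'd"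
  where "mean_field M H U \<theta> = prob_space.expectation M (\<lambda>\<omega>. H (\<theta>, U \<omega>))"

(* The Bochner integral is 0 by convention for non-integrable functions, so the
   existence of the expectation has to be required separately. *)
definition mean_field_exists ::
    "'w measure \<Rightarrow> ((real ^ 'd) \<times> (real ^ 'q) \<Rightarrow> real ^ 'd) \<Rightarrow> ('w \<Rightarrow> real ^ 'q) \<Rightarrow> bool"
  where "mean_field_exists M H U \<longleftrightarrow> (\<forall>\<theta>. integrable M (\<lambda>\<omega>. H (\<theta>, U \<omega>)))"

definition unique_zero :: "('a \<Rightarrow> 'b::zero) \<Rightarrow> 'a \<Rightarrow> bool"
  where "unique_zero h z \<longleftrightarrow> (\<forall>\<theta>. h \<theta> = 0 \<longleftrightarrow> \<theta> = z)"

definition mean_reverting :: "('a::real_inner \<Rightarrow> 'a) \<Rightarrow> 'a \<Rightarrow> bool"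
  where "mean_reverting h z \<longleftrightarrow> (\<forall>\<theta>. \<theta> \<noteq> z \<longrightarrow> (\<theta> - z) \<bullet> h \<theta> > 0)"

definition locally_uniform_limit ::
    "(nat \<Rightarrow> 'a::topological_space \<Rightarrow> 'b::metric_space) \<Rightarrow> ('a \<Rightarrow> 'b) \<Rightarrow> bool"
  where "locally_uniform_limit f g \<longleftrightarrow>
    (\<forall>x. \<exists>W. open W \<and> x \<in> W \<and> uniform_limit W f g sequentially)"

definition continuously_differentiable :: "(real ^ 'd \<Rightarrow> real ^ 'd) \<Rightarrow> bool"
  where "continuously_differentiable f \<longleftrightarrow>
    (\<forall>x. f differentiable (at x)) \<and> continuous_on UNIV (\<lambda>x. jacobian f (at x))"

definition scaled_diff ::
    "(nat \<Rightarrow> real ^ 'd \<Rightarrow> real ^ 'd) \<Rightarrow> (real ^ 'd \<Rightarrow> real ^ 'd) \<Rightarrow> real \<Rightarrow> real ^ 'd \<Rightarrow> nat \<Rightarrow> real ^ 'd"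
  where "scaled_diff hn h \<alpha> \<theta> n = (real n powr \<alpha>) *\<^sub>R (hn n \<theta> - h \<theta>)"

(* The quantity written E(h, alpha, theta) with a calligraphic E; meaningful only
   where scaled_diff converges. *)
definition error_limit ::
    "(nat \<Rightarrow> real ^ 'd \<Rightarrow> real ^ 'd) \<Rightarrow> (real ^ 'd \<Rightarrow> real ^ 'd) \<Rightarrow> real \<Rightarrow> real ^ 'd \<Rightarrow> real ^ 'd"
  where "error_limit hn h \<alpha> \<theta> = lim (scaled_diff hn h \<alpha> \<theta>)"

end

theory Submission
  imports Defs
begin

text \<open>
  On a small sphere around the zero \<open>z\<close> of the limit field, the radial component of that field
  is bounded below, hence so is that of the approximating fields from some index on. If the zero
  \<open>zn n\<close> of such a field lay outside the sphere, mean reversion towards \<open>zn n\<close> would contradict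
  this at the point of the sphere facing \<open>zn n\<close>. For the rate, local uniform convergence of the
  Jacobians to a continuous limit makes \<open>A\<close>, the limit Jacobian at \<open>z\<close>, a uniform approximation
  to all Jacobians near \<open>z\<close>; the mean value inequality then gives
  \<open>f n z + A *v (zn n - z) = o(norm (zn n - z))\<close>, and inverting \<open>A\<close> yields the limit.
\<close>

section \<open>Uniform convergence on compact sets and convergence of the zeros\<close>

lemma locally_uniform_limit_compact:
  assumes lim: "locally_uniform_limit f g" and "compact K"
  shows "uniform_limit K f g sequentially"
proof -
  obtain W where W: "\<And>x. open (W x)" "\<And>x. x \<in> W x"
      "\<And>x. uniform_limit (W x) f g sequentially"
    using lim unfolding locally_uniform_limit_def by metis
  obtain C where C: "finite C" "K \<subseteq> (\<Union>x\<in>C. W x)"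
    using \<open>compact K\<close> W(1,2) by (metis (no_types, lifting) UN_iff compactE_image subsetI)
  have "uniform_limit (\<Union>(W ` C)) f g sequentially"
    by (rule uniform_limit_on_Union) (use C(1) W(3) in auto)
  then show ?thesis
    using C(2) by (rule uniform_limit_on_subset)
qed

text \<open>A single sphere rules out zeros at every distance beyond it, so boundedness of
  \<open>zn\<close> is a by-product. The hypotheses on \<open>f n\<close> and \<open>zn n\<close>
  are eventual because the application controls them only from index 1 on.\<close>

lemma mean_reverting_zeros_tendsto:
  fixes f :: "nat \<Rightarrow> 'a::euclidean_space \<Rightarrow> 'a"
  assumes cont: "continuous_on UNIV g"
    and rev: "mean_reverting g z"
    and revn: "\<forall>\<^sub>F n in sequentially. mean_reverting (f n) (zn n)"
    and zero: "\<forall>\<^sub>F n in sequentially. f n (zn n) = 0"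
    and lim: "locally_uniform_limit f g"
  shows "zn \<longlonglongrightarrow> z"
proof (rule tendstoI)
  fix e :: real
  assume "e > 0"
  have "continuous_on (sphere z e) (\<lambda>x. (x - z) \<bullet> g x)"
    by (intro continuous_intros continuous_on_subset[OF cont]) auto
  then have "\<exists>y\<in>sphere z e. \<forall>x\<in>sphere z e. (y - z) \<bullet> g y \<le> (x - z) \<bullet> g x"
    using \<open>e > 0\<close> by (intro continuous_attains_inf[OF compact_sphere]) auto
  then obtain y where y: "y \<in> sphere z e"
      "\<And>x. x \<in> sphere z e \<Longrightarrow> (y - z) \<bullet> g y \<le> (x - z) \<bullet> g x"
    by blast
  define m where "m = (y - z) \<bullet> g y"
  have "y \<noteq> z"
    using y(1) \<open>e > 0\<close> by auto
  then have "m > 0"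
    using rev by (simp add: m_def mean_reverting_def)
  \<comment> \<open>On the sphere \<open>x - z\<close> has norm \<open>e\<close>, so by
    Cauchy-Schwarz an error below \<open>m / e\<close> in the field changes the radial component by
    less than its minimum \<open>m\<close>.\<close>
  have "\<forall>\<^sub>F n in sequentially. \<forall>x\<in>sphere z e. dist (f n x) (g x) < m / e"
    using locally_uniform_limit_compact[OF lim compact_sphere] \<open>m > 0\<close> \<open>e > 0\<close>
    by (simp add: uniform_limit_iff)
  with revn zero show "\<forall>\<^sub>F n in sequentially. dist (zn n) z < e"
  proof eventually_elim
    case (elim n)
    have pos: "(x - z) \<bullet> f n x > 0" if "x \<in> sphere z e" for x
    proof -
      have "norm (x - z) = e"
        using that by (simp add: dist_norm norm_minus_commute)
      then have "\<bar>(x - z) \<bullet> (f n x - g x)\<bar> \<le> e * dist (f n x) (g x)"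
        using Cauchy_Schwarz_ineq2[of "x - z" "f n x - g x"] by (simp add: dist_norm)
      also have "\<dots> < m"
        using elim(3) that \<open>e > 0\<close> by (simp add: field_simps)
      finally show ?thesis
        using y(2)[OF that] by (simp add: m_def inner_diff_right)
    qed
    show ?case
    proof (rule ccontr)
      assume far: "\<not> dist (zn n) z < e"
      define r where "r = norm (zn n - z)"
      have r: "r \<ge> e" "r > 0"
        using far \<open>e > 0\<close> by (auto simp: r_def dist_norm)
      \<comment> \<open>The point of the sphere on the segment from \<open>z\<close> to \<open>zn n\<close>: there the field would
        have to point away from both endpoints.\<close>
      define x where "x = z + (e / r) *\<^sub>R (zn n - z)"
      have "x \<in> sphere z e"
        using r \<open>e > 0\<close> by (simp add: x_def dist_norm flip: r_def)
      then have p: "(x - z) \<bullet> f n x > 0"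
        by (rule pos)
      \<comment> \<open>Mean reversion says nothing at the zero itself, and \<open>x\<close> would
        be \<open>zn n\<close> if \<open>r = e\<close>; positivity of the radial component excludes
        this.\<close>
      then have "x \<noteq> zn n"
        using elim(2) by auto
      then have "(x - zn n) \<bullet> f n x > 0"
        using elim(1) by (simp add: mean_reverting_def)
      moreover have "x - zn n = (1 - r / e) *\<^sub>R (x - z)"
        using r \<open>e > 0\<close> by (simp add: x_def algebra_simps)
      ultimately have "(1 - r / e) * ((x - z) \<bullet> f n x) > 0"
        by simp
      moreover have "1 - r / e \<le> 0"
        using r \<open>e > 0\<close> by (simp add: field_simps)
      ultimately show False
        using p by (simp add: zero_less_mult_iff)
    qed
  qed
qed

section \<open>Linearization at the zeros and the rate\<close>

lemma norm_matrix_vector_mult_bound: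
  obtains K where "K > 0"
    "\<And>(A :: real^'n^'m) (x :: real^'n). norm (A *v x) \<le> norm A * norm x * K"
proof -
  \<comment> \<open>Jacobians converge in the Euclidean norm of the entries, while the mean value
    inequality asks for the operator norm; boundedness of the bilinear product compares the
    two.\<close>
  have "bounded_bilinear (\<lambda>(A :: real^'n^'m) (x :: real^'n). A *v x)"
    unfolding bilinear_conv_bounded_bilinear[symmetric] bilinear_def
    by (auto intro!: linearI simp: algebra_simps matrix_vector_mult_add_rdistrib
        scaleR_matrix_vector_assoc matrix_vector_mult_scaleR)
  then show thesis
    using that by (metis bounded_bilinear.pos_bounded)
qed

lemma zeros_linearization:
  fixes f :: "nat \<Rightarrow> real^'d \<Rightarrow> real^'d" and g :: "real^'d \<Rightarrow> real^'d"
  assumes diff: "\<forall>\<^sub>F n in sequentially. \<forall>x. f n differentiable (at x)"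
    and cont: "continuous_on UNIV (\<lambda>x. jacobian g (at x))"
    and lim: "locally_uniform_limit (\<lambda>n x. jacobian (f n) (at x)) (\<lambda>x. jacobian g (at x))"
    and zn: "zn \<longlonglongrightarrow> z"
    and zero: "\<forall>\<^sub>F n in sequentially. f n (zn n) = 0"
    and "e > 0"
  shows "\<forall>\<^sub>F n in sequentially.
    norm (f n z + jacobian g (at z) *v (zn n - z)) \<le> e * norm (zn n - z)"
proof -
  define A where "A = jacobian g (at z)"
  obtain K where K: "K > 0"
      "\<And>(B :: real^'d^'d) (x :: real^'d). norm (B *v x) \<le> norm B * norm x * K"
    using norm_matrix_vector_mult_bound by metis
  \<comment> \<open>The distance from a Jacobian of \<open>f n\<close> to \<open>A\<close> splits
    into two errors below \<open>c\<close>, one from the convergence and one from the continuity of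
    the limit; times \<open>K\<close> they sum to at most \<open>e\<close>.\<close>
  define c where "c = e / (2 * K)"
  have "c > 0"
    using K(1) \<open>e > 0\<close> by (simp add: c_def)
  obtain d where d: "d > 0" "\<And>x. dist x z < d \<Longrightarrow> dist (jacobian g (at x)) A < c"
    using cont \<open>c > 0\<close> unfolding continuous_on_iff A_def by (metis UNIV_I)
  \<comment> \<open>Halving the radius gives a compact ball inside the open ball on which
    \<open>d\<close> controls the limit Jacobian.\<close>
  have "uniform_limit (cball z (d/2)) (\<lambda>n x. jacobian (f n) (at x)) (\<lambda>x. jacobian g (at x)) sequentially"
    using lim compact_cball by (rule locally_uniform_limit_compact)
  then have "\<forall>\<^sub>F n in sequentially. \<forall>x\<in>cball z (d/2).
      dist (jacobian (f n) (at x)) (jacobian g (at x)) < c"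
    using \<open>c > 0\<close> by (simp add: uniform_limit_iff)
  moreover have "\<forall>\<^sub>F n in sequentially. dist (zn n) z < d/2"
    by (rule tendstoD[OF zn]) (use \<open>d > 0\<close> in simp)
  ultimately have "\<forall>\<^sub>F n in sequentially. norm (f n z + A *v (zn n - z)) \<le> e * norm (zn n - z)"
    using diff zero
  proof eventually_elim
    case (elim n)
    \<comment> \<open>\<open>F\<close> is \<open>e\<close>-Lipschitz on the ball, and since
      \<open>f n\<close> vanishes at \<open>zn n\<close>, the difference
      \<open>F z - F (zn n)\<close> is exactly the expression to be bounded.\<close>
    define F where "F x = f n x - A *v x" for x
    have der: "(F has_derivative (\<lambda>v. (jacobian (f n) (at x) - A) *v v)) (at x within cball z (d/2))" for x
    proof -
      have "(f n has_derivative (\<lambda>v. jacobian (f n) (at x) *v v)) (at x)"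
        using elim(3) jacobian_works by blast
      then have "(F has_derivative (\<lambda>v. jacobian (f n) (at x) *v v - A *v v)) (at x)"
        unfolding F_def
        by (intro has_derivative_diff bounded_linear_imp_has_derivative matrix_vector_mul_bounded_linear)
      then show ?thesis
        by (simp add: matrix_vector_mult_diff_rdistrib has_derivative_at_withinI)
    qed
    have bound: "onorm (\<lambda>v. (jacobian (f n) (at x) - A) *v v) \<le> e" if x: "x \<in> cball z (d/2)" for x
    proof (rule onorm_bound)
      fix v :: "real^'d"
      have "dist (jacobian (f n) (at x)) A < c + c"
      proof (rule dist_triangle_less_add)
        show "dist (jacobian (f n) (at x)) (jacobian g (at x)) < c"
          using elim(1) x by blast
        show "dist A (jacobian g (at x)) < c"
          using d x by (simp add: dist_commute)
      qed
      then have "norm (jacobian (f n) (at x) - A) * K \<le> e"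
        using K(1) by (simp add: dist_norm c_def field_simps)
      then have "norm (jacobian (f n) (at x) - A) * K * norm v \<le> e * norm v"
        by (rule mult_right_mono) simp
      then show "norm ((jacobian (f n) (at x) - A) *v v) \<le> e * norm v"
        using K(2)[of "jacobian (f n) (at x) - A" v] by (simp add: mult_ac)
    qed (use \<open>e > 0\<close> in simp)
    have "norm (F z - F (zn n)) \<le> e * norm (z - zn n)"
      by (rule differentiable_bound[OF convex_cball der bound])
        (use elim(2) \<open>d > 0\<close> in \<open>auto simp: dist_commute\<close>)
    then show ?case
      using elim(4) by (simp add: F_def matrix_vector_mult_diff_distrib norm_minus_commute algebra_simps)
  qed
  then show ?thesis
    by (simp add: A_def)
qed

text \<open>Here \<open>w n\<close> stands for the approximating field at the limit zero and
  \<open>u n\<close> for the displacement of its zero. The remainder is only small relative to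
  \<open>u n\<close>, so the scaled displacement must first be shown bounded; then the scaled
  remainder vanishes and applying the inverse of \<open>A\<close> gives the limit.\<close>

lemma scaled_zeros_tendsto:
  fixes A :: "real^'d^'d" and w u :: "nat \<Rightarrow> real^'d"
  assumes inv: "invertible A"
    and lin: "\<And>e. e > 0 \<Longrightarrow> \<forall>\<^sub>F n in sequentially. norm (w n + A *v u n) \<le> e * norm (u n)"
    and lim: "(\<lambda>n. c n *\<^sub>R w n) \<longlonglongrightarrow> E"
  shows "(\<lambda>n. c n *\<^sub>R u n) \<longlonglongrightarrow> - (matrix_inv A *v E)"
proof -
  define B where "B = matrix_inv A"
  have BA: "B *v (A *v x) = x" for x
  proof -
    have "B ** A = mat 1"
      using inv unfolding B_def matrix_inv_def invertible_def by (rule someI2_ex) simp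
    then show ?thesis
      by (simp add: matrix_vector_mul_assoc)
  qed
  obtain K where K: "K > 0" "\<And>x. norm (B *v x) \<le> norm x * K"
    using bounded_linear.pos_bounded[OF matrix_vector_mul_bounded_linear] by metis
  define r where "r n = c n *\<^sub>R (w n + A *v u n)" for n
  have r: "\<forall>\<^sub>F n in sequentially. norm (r n) \<le> e * norm (c n *\<^sub>R u n)" if "e > 0" for e
    using lin[OF that]
  proof eventually_elim
    case (elim n)
    then have "\<bar>c n\<bar> * norm (w n + A *v u n) \<le> \<bar>c n\<bar> * (e * norm (u n))"
      by (rule mult_left_mono) simp
    then show ?case
      by (simp add: r_def mult_ac)
  qed
  have u: "c n *\<^sub>R u n = B *v r n - B *v (c n *\<^sub>R w n)" for n
    by (simp add: r_def BA matrix_vector_right_distrib matrix_vector_mult_scaleR scaleR_add_right)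
  have "Bseq (\<lambda>n. c n *\<^sub>R w n)"
    using lim by (intro convergent_imp_Bseq convergentI)
  then obtain C where C: "\<And>n. norm (c n *\<^sub>R w n) \<le> C"
    by (auto simp: Bseq_def)
  \<comment> \<open>With this tolerance the remainder term, after applying \<open>B\<close>, is at
    most half of \<open>norm (c n *\<^sub>R u n)\<close> and can be absorbed on the left, leaving
    twice \<open>C * K\<close>.\<close>
  have "1 / (2 * K) > 0"
    using K(1) by simp
  from r[OF this] have ubound: "\<forall>\<^sub>F n in sequentially. norm (c n *\<^sub>R u n) \<le> 2 * (C * K)"
  proof eventually_elim
    case (elim n)
    have "norm (c n *\<^sub>R u n) \<le> norm (B *v r n) + norm (B *v (c n *\<^sub>R w n))"
      by (subst u) (rule norm_triangle_ineq4)
    also have "\<dots> \<le> norm (r n) * K + norm (c n *\<^sub>R w n) * K"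
      by (intro add_mono K(2))
    also have "\<dots> \<le> norm (c n *\<^sub>R u n) / 2 + C * K"
    proof (rule add_mono)
      show "norm (r n) * K \<le> norm (c n *\<^sub>R u n) / 2"
        using elim K(1) by (simp add: field_simps)
      show "norm (c n *\<^sub>R w n) * K \<le> C * K"
        using C K(1) by (intro mult_right_mono) auto
    qed
    finally show ?case
      by simp
  qed
  have "r \<longlonglongrightarrow> 0"
  proof (rule tendstoI)
    fix e :: real
    assume "e > 0"
    \<comment> \<open>\<open>D\<close> is positive and strictly above the eventual bound, so the
      relative tolerance \<open>e / D\<close> yields an absolute error below
      \<open>e\<close>.\<close>
    define D where "D = \<bar>2 * (C * K)\<bar> + 1"
    have "D > 0"
      by (simp add: D_def)
    with \<open>e > 0\<close> have "e / D > 0"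
      by simp
    from r[OF this] ubound show "\<forall>\<^sub>F n in sequentially. dist (r n) 0 < e"
    proof eventually_elim
      case (elim n)
      have "norm (c n *\<^sub>R u n) < D"
        using elim(2) by (simp add: D_def)
      with \<open>e / D > 0\<close> have "e / D * norm (c n *\<^sub>R u n) < e / D * D"
        by (rule mult_strict_left_mono[rotated])
      then show ?case
        using elim(1) \<open>D > 0\<close> by simp
    qed
  qed
  then have "(\<lambda>n. B *v r n - B *v (c n *\<^sub>R w n)) \<longlonglongrightarrow> B *v 0 - B *v E"
    by (intro tendsto_diff bounded_linear.tendsto[OF matrix_vector_mul_bounded_linear] lim)
  then show ?thesis
    unfolding u by (simp add: B_def)
qed

section \<open>Application to the expected fields\<close>

theorem theorem2p6:
  fixes M :: "'w measure"
    and H :: "(real ^ 'd) \<times> (real ^ 'q) \<Rightarrow> real ^ 'd"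
    and U :: "'w \<Rightarrow> real ^ 'q"
    and Us :: "nat \<Rightarrow> 'w \<Rightarrow> real ^ 'q"
    and h :: "real ^ 'd \<Rightarrow> real ^ 'd"
    and hn :: "nat \<Rightarrow> real ^ 'd \<Rightarrow> real ^ 'd"
    and \<theta>s :: "real ^ 'd"
    and \<theta>sn :: "nat \<Rightarrow> real ^ 'd"
  assumes "prob_space M"
    and "H \<in> borel_measurable borel"
    and "U \<in> borel_measurable M"
    and "\<forall>n\<ge>1. Us n \<in> borel_measurable M"
    and "mean_field_exists M H U"
    and "\<forall>n\<ge>1. mean_field_exists M H (Us n)"
    and "h = mean_field M H U"
    and "\<forall>n\<ge>1. hn n = mean_field M H (Us n)"
    and "unique_zero h \<theta>s"
    and "\<forall>n\<ge>1. unique_zero (hn n) (\<theta>sn n)"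
    and "continuous_on UNIV h"
    and "\<forall>n\<ge>1. continuous_on UNIV (hn n)"
    and "mean_reverting h \<theta>s"
    and "\<forall>n\<ge>1. mean_reverting (hn n) (\<theta>sn n)"
    and "locally_uniform_limit hn h"
  shows "\<theta>sn \<longlonglongrightarrow> \<theta>s \<and>
    (continuously_differentiable h \<and>
     (\<forall>n\<ge>1. continuously_differentiable (hn n)) \<and>
     invertible (jacobian h (at \<theta>s)) \<and>
     locally_uniform_limit (\<lambda>n \<theta>. jacobian (hn n) (at \<theta>)) (\<lambda>\<theta>. jacobian h (at \<theta>))
     \<longrightarrow>
     (\<forall>\<alpha>::real. \<alpha> \<noteq> 0 \<and> (\<forall>\<theta>. convergent (scaled_diff hn h \<alpha> \<theta>))
       \<longrightarrow> (\<lambda>n. (real n powr \<alpha>) *\<^sub>R (\<theta>sn n - \<theta>s))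
             \<longlonglongrightarrow> - (matrix_inv (jacobian h (at \<theta>s)) *v error_limit hn h \<alpha> \<theta>s)))"
proof -
  have ev: "\<forall>\<^sub>F n in sequentially. n \<ge> (1::nat)"
    by (rule eventually_ge_at_top)
  have "\<forall>\<^sub>F n in sequentially. mean_reverting (hn n) (\<theta>sn n)"
    by (rule eventually_mono[OF ev]) (use assms(14) in simp)
  moreover have zero: "\<forall>\<^sub>F n in sequentially. hn n (\<theta>sn n) = 0"
    by (rule eventually_mono[OF ev]) (use assms(10) in \<open>simp add: unique_zero_def\<close>)
  ultimately have conv: "\<theta>sn \<longlonglongrightarrow> \<theta>s"
    using assms(11,13,15) by (intro mean_reverting_zeros_tendsto)
  moreover have "(\<lambda>n. (real n powr \<alpha>) *\<^sub>R (\<theta>sn n - \<theta>s))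
      \<longlonglongrightarrow> - (matrix_inv (jacobian h (at \<theta>s)) *v error_limit hn h \<alpha> \<theta>s)"
    if C1: "continuously_differentiable h" "\<forall>n\<ge>1. continuously_differentiable (hn n)"
      and inv: "invertible (jacobian h (at \<theta>s))"
      and lim: "locally_uniform_limit (\<lambda>n \<theta>. jacobian (hn n) (at \<theta>)) (\<lambda>\<theta>. jacobian h (at \<theta>))"
      and E: "convergent (scaled_diff hn h \<alpha> \<theta>s)" for \<alpha>
  proof (rule scaled_zeros_tendsto[OF inv])
    fix e :: real
    assume "e > 0"
    have "\<forall>\<^sub>F n in sequentially. \<forall>x. hn n differentiable (at x)"
      by (rule eventually_mono[OF ev]) (use C1(2) in \<open>simp add: continuously_differentiable_def\<close>)
    moreover have "continuous_on UNIV (\<lambda>x. jacobian h (at x))"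
      using C1(1) by (simp add: continuously_differentiable_def)
    ultimately show "\<forall>\<^sub>F n in sequentially.
        norm (hn n \<theta>s + jacobian h (at \<theta>s) *v (\<theta>sn n - \<theta>s)) \<le> e * norm (\<theta>sn n - \<theta>s)"
      using lim conv zero \<open>e > 0\<close> by (rule zeros_linearization)
  next
    \<comment> \<open>Because \<open>h\<close> vanishes at \<open>\<theta>s\<close>, the scaled
      difference there is the scaled value of \<open>hn n\<close> alone, which plays the role of
      \<open>c n *\<^sub>R w n\<close>.\<close>
    have "h \<theta>s = 0"
      using assms(9) by (simp add: unique_zero_def)
    then have "scaled_diff hn h \<alpha> \<theta>s = (\<lambda>n. (real n powr \<alpha>) *\<^sub>R hn n \<theta>s)"
      by (simp add: scaled_diff_def fun_eq_iff)
    then show "(\<lambda>n. (real n powr \<alpha>) *\<^sub>R hn n \<theta>s) \<longlonglongrightarrow> error_limit hn h \<alpha> \<theta>s"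
      using E by (simp add: error_limit_def convergent_LIMSEQ_iff)
  qed
  ultimately show ?thesis
    by blast
qed

end
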